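(* Let $1<p<\infty$, $\alpha\in\mathbb{R}$, let $v,w$ be weight functions on $\mathbb{R}$, and let $\phi\in L^1(\mathbb{R})$ be such that $$B_{\sup}:=\int_{\mathbb{R}} \frac{|\phi(t)|}{|t|^{2\alpha+2-\frac1p}}\left(\sup_{y\in\mathbb{R}}\frac{v(ty)}{w(y)}\right)^{1/p}dt<\infty .$$ Then the operator $H_{\alpha,\phi}:L^p_w(\mathbb{R})\to L^p_v(\mathbb{R})$ is bounded and, for every $f\in L^p_w(\mathbb{R})$, $$\|H_{\alpha,\phi}f\|_{L^p_v(\mathbb{R})}\le B_{\sup}\,\|f\|_{L^p_w(\mathbb{R})}.$$
   Context: A weight function on $\mathbb{R}$ is a measurable function $v:\mathbb{R}\to[0,\infty]$ that is positive and finite almost everywhere. $L^p_v(\mathbb{R})$ is the weighted Lebesgue space with norm $\|f\|_{L^p_v(\mathbb{R})}=\left(\int_{\mathbb{R}}|f(x)|^p v(x)\,dx\right)^{1/p}$. The Dunkl-Hausdorff operator is $$H_{\alpha,\phi}f(x)=\int_{\mathbb{R}}\frac{|\phi(t)|}{|t|^{2\alpha+2}}f\left(\frac{x}{t}\right)dt .$$ It is bounded from $L^p_w(\mathbb{R})$ to $L^p_v(\mathbb{R})$ if for every $f\in L^p_w(\mathbb{R})$ the integral converges absolutely for a.e. $x$ and there is a finite constant $C$ with $\|H_{\alpha,\phi}f\|_{L^p_v(\mathbb{R})}\le C\|f\|_{L^p_w(\mathbb{R})}$ for all such $f$. Since weights are positive and finite only a.e., $\sup_{y}$ is the essential supremum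 over $y$ (for $t\neq0$), with values in $[0,\infty]$, and $0\cdot\infty=0$. *)

theory Defs
  imports "HOL-Probability.Essential_Supremum"
begin

text \<open>
  Measurability, "almost everywhere" and integrals all refer to Lebesgue measure on the
  Lebesgue (not merely Borel) sigma-algebra. The scalars are a type
  \<open>'k :: {real_normed_field, banach, second_countable_topology}\<close>, in particular the real
  or the complex numbers.
\<close>

text \<open>Powers with values in \<open>[0,\<infinity>]\<close>, meant for exponents \<open>a > 0\<close>, so that \<open>\<infinity>\<close> to the power \<open>a\<close> is \<open>\<infinity>\<close>.\<close>

definition ennpowr :: "ennreal \<Rightarrow> real \<Rightarrow> ennreal"
  where "ennpowr x a = (if x = \<infinity> then \<infinity> else ennreal (enn2real x powr a))"

definition weight_function :: "(real \<Rightarrow> ennreal) \<Rightarrow> bool"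
  where "weight_function v \<longleftrightarrow>
    v \<in> borel_measurable lebesgue \<and> (AE x in lebesgue. 0 < v x \<and> v x < \<infinity>)"

definition wLp_norm :: "real \<Rightarrow> (real \<Rightarrow> ennreal) \<Rightarrow> (real \<Rightarrow> 'k::real_normed_vector) \<Rightarrow> ennreal"
  where "wLp_norm p v f = ennpowr (\<integral>\<^sup>+x. ennreal (norm (f x) powr p) * v x \<partial>lebesgue) (1 / p)"

text \<open>The space consists of functions; functions that agree almost everywhere are not identified.\<close>

definition wLp :: "real \<Rightarrow> (real \<Rightarrow> ennreal) \<Rightarrow> (real \<Rightarrow> 'k::real_normed_vector) set"
  where "wLp p v = {f. f \<in> borel_measurable lebesgue \<and> wLp_norm p v f < \<infinity>}"

text \<open>
  In the kernels below, the value produced by division by zero at \<open>t = 0\<close> is irrelevant,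
  since \<open>{0}\<close> is a null set.
\<close>

definition dunkl_hausdorff_integrand ::
    "real \<Rightarrow> (real \<Rightarrow> 'k) \<Rightarrow> (real \<Rightarrow> 'k) \<Rightarrow> real \<Rightarrow> real
      \<Rightarrow> 'k::{real_normed_field, banach, second_countable_topology}"
  where "dunkl_hausdorff_integrand \<alpha> \<phi> f x t =
    (norm (\<phi> t) / \<bar>t\<bar> powr (2 * \<alpha> + 2)) *\<^sub>R f (x / t)"

definition dunkl_hausdorff ::
    "real \<Rightarrow> (real \<Rightarrow> 'k) \<Rightarrow> (real \<Rightarrow> 'k) \<Rightarrow> real
      \<Rightarrow> 'k::{real_normed_field, banach, second_countable_topology}"
  where "dunkl_hausdorff \<alpha> \<phi> f x = (\<integral>t. dunkl_hausdorff_integrand \<alpha> \<phi> f x t \<partial>lebesgue)"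

text \<open>
  Absolute convergence of the defining integral is Bochner integrability. It has to be demanded
  explicitly because the Bochner integral of a non-integrable function is \<open>0\<close>.
\<close>

definition dunkl_hausdorff_bounded ::
    "real \<Rightarrow> real \<Rightarrow> (real \<Rightarrow> ennreal) \<Rightarrow> (real \<Rightarrow> ennreal)
      \<Rightarrow> (real \<Rightarrow> 'k::{real_normed_field, banach, second_countable_topology}) \<Rightarrow> bool"
  where "dunkl_hausdorff_bounded p \<alpha> w v \<phi> \<longleftrightarrow>
    (\<forall>f\<in>wLp p w. (AE x in lebesgue. integrable lebesgue (dunkl_hausdorff_integrand \<alpha> \<phi> f x))
        \<and> dunkl_hausdorff \<alpha> \<phi> f \<in> wLp p v)
    \<and> (\<exists>C\<ge>0. \<forall>f\<in>wLp p w. wLp_norm p v (dunkl_hausdorff \<alpha> \<phi> f) \<le> ennreal C * wLp_norm p w f)"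

definition B_sup ::
    "real \<Rightarrow> real \<Rightarrow> (real \<Rightarrow> ennreal) \<Rightarrow> (real \<Rightarrow> ennreal)
      \<Rightarrow> (real \<Rightarrow> 'k::real_normed_vector) \<Rightarrow> ennreal"
  where "B_sup p \<alpha> w v \<phi> =
    (\<integral>\<^sup>+t. ennreal (norm (\<phi> t) / \<bar>t\<bar> powr (2 * \<alpha> + 2 - 1 / p))
        * ennpowr (esssup lebesgue (\<lambda>y. v (t * y) / w y)) (1 / p) \<partial>lebesgue)"

end

theory Submission
  imports Defs
begin

text \<open>
  Write \<open>S t\<close> for the essential supremum of \<open>v (t y) / w y\<close> over \<open>y\<close>. The substitution
  \<open>x = t y\<close> shows that for \<open>t \<noteq> 0\<close> the dilation \<open>f \<mapsto> f (\<cdot> / t)\<close> maps \<open>L\<^sup>p\<close> with weight \<open>w\<close> to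
  \<open>L\<^sup>p\<close> with weight \<open>v\<close> with norm at most \<open>u t = (\<bar>t\<bar> S t) powr (1 / p)\<close>
  (\<open>nn_integral_dilation_weight_le\<close>). The operator integrates these dilations against the kernel
  \<open>k t = \<bar>\<phi> t\<bar> / \<bar>t\<bar> powr (2 \<alpha> + 2)\<close>, and \<open>B_sup\<close> is exactly \<open>\<integral> k u\<close>. The theorem is
  therefore an instance of Minkowski's integral inequality.

  Minkowski's inequality is used in a form that needs no duality and no a priori finiteness. The
  dilations are normalised: \<open>k t f (x / t) = (k t u t) \<cdot> (f (x / t) / u t)\<close>, where the functions
  \<open>f (\<cdot> / t) / u t\<close> all lie in one ball and \<open>k u\<close> has total mass \<open>B_sup\<close>. An integral of elements
  of a ball against a measure of mass \<open>B_sup\<close> lies in \<open>B_sup\<close> times that ball, by Jensen's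
  inequality for \<open>x \<mapsto> x\<^sup>p\<close> (\<open>nn_integral_weighted_Jensen\<close>) and Fubini's theorem (\<open>nn_integral_average_power_le\<close>). The
  normalisation is legitimate for almost every \<open>t\<close>: positivity of \<open>v\<close> and finiteness of \<open>w\<close> give
  \<open>u t > 0\<close>, and \<open>B_sup < \<infinity>\<close> forces \<open>k t = 0\<close> almost everywhere on the set where \<open>u t = \<infinity>\<close>.
  The resulting estimate for \<open>\<bar>f\<bar>\<close> (\<open>hausdorff_average_estimate\<close>) also makes the integral of
  absolute values finite for almost every \<open>x\<close>, which is absolute convergence.

  Fubini's theorem needs functions that are measurable for a product \<open>\<sigma>\<close>-algebra, and for
  \<open>(x, t) \<mapsto> f (x / t)\<close> this is immediate only if \<open>f\<close> is Borel. All functions are therefore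
  replaced by Borel functions equal to them almost everywhere. This changes nothing because
  \<open>y \<mapsto> t y\<close> and \<open>t \<mapsto> x / t\<close> pull null sets back to null sets when \<open>t \<noteq> 0\<close>,
  respectively \<open>x \<noteq> 0\<close> (\<open>AE_lborel_compose\<close>).
\<close>

section \<open>Powers with values in the extended nonnegative reals\<close>

lemma ennpowr_ennreal: "0 \<le> r \<Longrightarrow> ennpowr (ennreal r) a = ennreal (r powr a)"
  by (simp add: ennpowr_def)

lemma ennpowr_top [simp]: "ennpowr top a = top"
  by (simp add: ennpowr_def)

lemma ennpowr_0 [simp]: "ennpowr 0 a = 0"
  by (simp add: ennpowr_def)

lemma ennpowr_1 [simp]: "ennpowr x 1 = x"
  by (cases x) (simp_all add: ennpowr_ennreal)

lemma ennpowr_eq_0_iff [simp]: "ennpowr x a = 0 \<longleftrightarrow> x = 0"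
  by (cases x) (auto simp: ennpowr_ennreal)

lemma ennpowr_eq_top_iff [simp]: "ennpowr x a = top \<longleftrightarrow> x = top"
  by (cases x) (auto simp: ennpowr_ennreal)

lemma ennpowr_less_top_iff [simp]: "ennpowr x a < top \<longleftrightarrow> x < top"
  by (simp flip: top.not_eq_extremum)

lemma ennpowr_mult: "ennpowr (x * y) a = ennpowr x a * ennpowr y a"
  by (cases x; cases y)
    (auto simp: ennpowr_ennreal powr_mult ennreal_mult_top ennreal_top_mult simp flip: ennreal_mult)

lemma ennpowr_ennpowr: "ennpowr (ennpowr x a) b = ennpowr x (a * b)"
  by (cases x) (auto simp: ennpowr_ennreal powr_powr)

lemma ennpowr_inverse: "0 < a \<Longrightarrow> ennpowr (inverse x) a = inverse (ennpowr x a)"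
proof (cases x)
  case (real r)
  then show ?thesis
    by (cases "r = 0") (simp_all add: ennpowr_ennreal inverse_ennreal inverse_powr)
qed simp

lemma ennpowr_mono: "0 \<le> a \<Longrightarrow> x \<le> y \<Longrightarrow> ennpowr x a \<le> ennpowr y a"
  by (cases x; cases y) (auto simp: ennpowr_ennreal powr_mono2 top_unique)

lemma borel_measurable_ennpowr [measurable]:
  assumes [measurable]: "f \<in> borel_measurable M"
  shows "(\<lambda>x. ennpowr (f x) a) \<in> borel_measurable M"
proof -
  have "{x \<in> space M. f x = \<infinity>} \<in> sets M" by measurable
  then show ?thesis
    unfolding ennpowr_def by measurable
qed

section \<open>Averages and Minkowski's inequality\<close>

text \<open>
  The right-hand side is the tangent at \<open>c powr p\<close> of the concave function \<open>x \<mapsto> x powr (1 / p)\<close>,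
  evaluated at \<open>x = g powr p\<close>. Such a bound is affine in \<open>g powr p\<close> and can be integrated.
\<close>

lemma le_ennpowr_tangent:
  fixes g :: ennreal and c p :: real
  assumes "1 < p" "0 < c"
  shows "g \<le> ennreal (c powr (1 - p) / p) * ennpowr g p + ennreal ((1 - 1 / p) * c)"
proof (cases g)
  case (real r)
  have "r \<le> c powr (1 - p) / p * r powr p + (1 - 1 / p) * c"
  proof (cases "r = 0")
    case False
    with real have "0 < r" by simp
    then have "r * (c powr ((1 - p) / p) * c powr (1 - 1 / p))
        \<le> 1 / p * (r powr p * c powr (1 - p)) + (1 - 1 / p) * c"
      using assms Youngs_inequality_0[of "1 / p" "1 - 1 / p" "r powr p * c powr (1 - p)" c]
      by (simp add: powr_mult powr_powr mult_ac)
    also have "c powr ((1 - p) / p) * c powr (1 - 1 / p) = 1"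
      using assms by (simp add: diff_divide_distrib flip: powr_add)
    finally show ?thesis by (simp add: mult_ac)
  qed (use assms in auto)
  then show ?thesis
    using assms real by (simp add: ennpowr_ennreal flip: ennreal_mult ennreal_plus)
qed (use assms in \<open>simp add: ennreal_mult_top\<close>)

text \<open>
  This is Jensen's inequality for the measure with density \<open>a\<close>, written without dividing by its
  total mass so that it stays true when that mass is \<open>0\<close> or \<open>\<infinity>\<close>. It follows by integrating the
  tangent bound and choosing the best point of tangency.
\<close>

lemma nn_integral_weighted_Jensen:
  fixes p :: real
  assumes p: "1 < p" and [measurable]: "a \<in> borel_measurable M" "g \<in> borel_measurable M"
  shows "ennpowr (\<integral>\<^sup>+t. a t * g t \<partial>M) p
    \<le> ennpowr (\<integral>\<^sup>+t. a t \<partial>M) (p - 1) * (\<integral>\<^sup>+t. a t * ennpowr (g t) p \<partial>M)"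
    (is "_ \<le> ennpowr ?A _ * ?J")
proof -
  consider "?A = 0 \<or> ?J = 0" | "?A \<noteq> 0" "?J \<noteq> 0" "?A = top \<or> ?J = top"
    | "?A \<noteq> 0" "?J \<noteq> 0" "?A < top" "?J < top"
    unfolding top.not_eq_extremum[symmetric] by blast
  then show ?thesis
  proof cases
    case 1
    then have "AE t in M. a t = 0 \<or> g t = 0"
      by (auto simp: nn_integral_0_iff_AE elim: eventually_mono)
    then have "(\<integral>\<^sup>+t. a t * g t \<partial>M) = 0"
      by (subst nn_integral_0_iff_AE) (auto elim: eventually_mono)
    then show ?thesis by simp
  next
    case 2
    then have "ennpowr ?A (p - 1) * ?J = top"
      by (simp add: ennreal_mult_eq_top_iff)
    then show ?thesis by simp
  next
    case 3
    then obtain b j where b: "?A = ennreal b" "0 < b" and j: "?J = ennreal j" "0 < j"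
      by (cases ?A; cases ?J) auto
    \<comment> \<open>the point of tangency that minimises the integrated bound\<close>
    define c where "c = (j / b) powr (1 / p)"
    have c: "0 < c" using b j by (simp add: c_def)
    have "(\<integral>\<^sup>+t. a t * g t \<partial>M)
      \<le> (\<integral>\<^sup>+t. ennreal (c powr (1 - p) / p) * (a t * ennpowr (g t) p) + ennreal ((1 - 1 / p) * c) * a t \<partial>M)"
    proof (rule nn_integral_mono)
      fix t
      have "a t * g t \<le> a t * (ennreal (c powr (1 - p) / p) * ennpowr (g t) p + ennreal ((1 - 1 / p) * c))"
        by (intro mult_left_mono le_ennpowr_tangent p c) simp
      then show "a t * g t
          \<le> ennreal (c powr (1 - p) / p) * (a t * ennpowr (g t) p) + ennreal ((1 - 1 / p) * c) * a t"
        by (simp only: distrib_left mult_ac)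
    qed
    also have "\<dots> = ennreal (c powr (1 - p) / p) * ?J + ennreal ((1 - 1 / p) * c) * ?A"
      by (simp add: nn_integral_add nn_integral_cmult)
    also have "\<dots> = ennreal (c powr (1 - p) / p * j + (1 - 1 / p) * c * b)"
      using p c b j by (simp flip: ennreal_mult ennreal_plus)
    also have "c powr (1 - p) / p * j + (1 - 1 / p) * c * b = b powr (1 - 1 / p) * j powr (1 / p)"
    proof -
      have "c powr (1 - p) * j = b powr (1 - 1 / p) * j powr (1 / p)"
        using p b j by (simp add: c_def powr_powr powr_divide diff_divide_distrib powr_diff)
      moreover have "c * b = b powr (1 - 1 / p) * j powr (1 / p)"
        using p b j by (simp add: c_def powr_divide powr_diff)
      ultimately show ?thesis
        by (simp add: algebra_simps flip: add_divide_distrib)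
    qed
    finally have "ennpowr (\<integral>\<^sup>+t. a t * g t \<partial>M) p
        \<le> ennpowr (ennreal (b powr (1 - 1 / p) * j powr (1 / p))) p"
      using p by (intro ennpowr_mono) auto
    also have "\<dots> = ennreal (b powr (p - 1) * j)"
      using p b j by (simp add: ennpowr_ennreal powr_mult powr_powr left_diff_distrib)
    finally show ?thesis
      using b j by (simp add: ennpowr_ennreal ennreal_mult)
  qed
qed

text \<open>
  The factor \<open>(\<integral> a) powr (p - 1)\<close> from Jensen's inequality does not depend on \<open>x\<close>, so
  after exchanging the integrals each \<open>g (\<cdot>) t\<close> contributes at most \<open>a t C\<close>, and one more factor
  \<open>\<integral> a\<close> appears.
\<close>

lemma (in pair_sigma_finite) nn_integral_average_power_le:
  fixes p :: real and g :: "'a \<Rightarrow> 'b \<Rightarrow> ennreal"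
  assumes p: "1 < p"
    and [measurable]: "a \<in> borel_measurable M2" "v \<in> borel_measurable M1"
      "case_prod g \<in> borel_measurable (M1 \<Otimes>\<^sub>M M2)"
    and le: "AE t in M2. (\<integral>\<^sup>+x. ennpowr (g x t) p * v x \<partial>M1) \<le> C"
  shows "(\<integral>\<^sup>+x. ennpowr (\<integral>\<^sup>+t. a t * g x t \<partial>M2) p * v x \<partial>M1) \<le> ennpowr (\<integral>\<^sup>+t. a t \<partial>M2) p * C"
proof -
  let ?A = "\<integral>\<^sup>+t. a t \<partial>M2"
  have "(\<integral>\<^sup>+x. ennpowr (\<integral>\<^sup>+t. a t * g x t \<partial>M2) p * v x \<partial>M1)
      \<le> (\<integral>\<^sup>+x. ennpowr ?A (p - 1) * (\<integral>\<^sup>+t. a t * ennpowr (g x t) p \<partial>M2) * v x \<partial>M1)"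
    using p by (intro nn_integral_mono mult_right_mono nn_integral_weighted_Jensen) auto
  also have "\<dots> = (\<integral>\<^sup>+x. ennpowr ?A (p - 1) * (\<integral>\<^sup>+t. a t * ennpowr (g x t) p * v x \<partial>M2) \<partial>M1)"
    by (intro nn_integral_cong) (simp add: nn_integral_multc, simp add: mult.assoc)
  also have "\<dots> = ennpowr ?A (p - 1) * (\<integral>\<^sup>+x. (\<integral>\<^sup>+t. a t * ennpowr (g x t) p * v x \<partial>M2) \<partial>M1)"
    by (intro nn_integral_cmult) measurable
  also have "(\<integral>\<^sup>+x. (\<integral>\<^sup>+t. a t * ennpowr (g x t) p * v x \<partial>M2) \<partial>M1)
      = (\<integral>\<^sup>+t. (\<integral>\<^sup>+x. a t * ennpowr (g x t) p * v x \<partial>M1) \<partial>M2)"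
    by (rule Fubini'[symmetric]) measurable
  also have "\<dots> = (\<integral>\<^sup>+t. a t * (\<integral>\<^sup>+x. ennpowr (g x t) p * v x \<partial>M1) \<partial>M2)"
    by (intro nn_integral_cong) (simp add: nn_integral_cmult mult.assoc)
  also have "\<dots> \<le> (\<integral>\<^sup>+t. a t * C \<partial>M2)"
    using le by (intro nn_integral_mono_AE) (auto elim!: eventually_mono intro!: mult_left_mono)
  also have "\<dots> = ?A * C" by (simp add: nn_integral_multc)
  finally have "(\<integral>\<^sup>+x. ennpowr (\<integral>\<^sup>+t. a t * g x t \<partial>M2) p * v x \<partial>M1) \<le> ennpowr ?A (p - 1) * ?A * C"
    by (simp add: mult_left_mono mult.assoc)
  also have "ennpowr ?A (p - 1) * ?A = ennpowr ?A p"
    using p by (cases ?A) (auto simp: ennpowr_ennreal ennreal_mult_top powr_diff simp flip: ennreal_mult)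
  finally show ?thesis .
qed

section \<open>Dilations and null sets\<close>

text \<open>
  The exceptional set of \<open>P \<circ> h\<close> lies in the image under \<open>g\<close> of the exceptional set of \<open>P\<close>, apart
  from the point \<open>0\<close>, and differentiable maps send null sets to null sets.
\<close>

lemma AE_lborel_compose:
  fixes h g :: "real \<Rightarrow> real"
  assumes P: "AE y in lborel. P y"
    and g: "g differentiable_on - {0}"
    and inv: "\<And>y. y \<noteq> 0 \<Longrightarrow> h y \<noteq> 0 \<and> g (h y) = y"
  shows "AE y in lborel. P (h y)"
proof -
  obtain N where N: "negligible N" "{y. \<not> P y} \<subseteq> N"
    using P AE_completion[OF P] by (auto simp: eventually_ae_filter_negligible)
  have "negligible (g ` (N - {0}))"
  proof (rule negligible_differentiable_image_negligible)
    show "negligible (N - {0})"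
      using N(1) by (rule negligible_diff)
    show "g differentiable_on (N - {0})"
      using g by (rule differentiable_on_subset) auto
  qed simp
  then have "negligible (insert 0 (g ` (N - {0})))"
    by simp
  moreover have "{y. \<not> P (h y)} \<subseteq> insert 0 (g ` (N - {0}))"
  proof
    fix y assume "y \<in> {y. \<not> P (h y)}"
    then have "h y \<in> N" using N(2) by auto
    then show "y \<in> insert 0 (g ` (N - {0}))"
      using inv[of y] by (cases "y = 0") (auto intro!: image_eqI[of y g "h y"])
  qed
  ultimately have "AE y in lebesgue. P (h y)"
    unfolding eventually_ae_filter_negligible by blast
  then show ?thesis by (simp add: AE_completion_iff)
qed

lemma AE_lborel_dilation:
  fixes t :: real
  assumes "AE y in lborel. P y" "t \<noteq> 0"
  shows "AE y in lborel. P (t * y)"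
  using assms(1) by (rule AE_lborel_compose[where g = "\<lambda>s. s / t"])
    (use assms(2) in \<open>auto simp: differentiable_on_def intro!: differentiable_divide\<close>)

lemma AE_lborel_reciprocal:
  fixes x :: real
  assumes "AE y in lborel. P y" "x \<noteq> 0"
  shows "AE t in lborel. P (x / t)"
  using assms(1) by (rule AE_lborel_compose[where g = "\<lambda>s. x / s"])
    (use assms(2) in \<open>auto simp: differentiable_on_def intro!: differentiable_divide\<close>)

section \<open>The essential supremum of the quotient of the weights\<close>

text \<open>
  The sublevel sets of the essential supremum are the sets of those \<open>t\<close> for which a section of a
  measurable set is null, so Fubini's theorem makes them measurable.
\<close>

lemma (in sigma_finite_measure) borel_measurable_esssup_section:
  fixes h :: "'b \<Rightarrow> 'a \<Rightarrow> 'c::{second_countable_topology, dense_linorder, linorder_topology, complete_linorder}"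
  assumes [measurable]: "case_prod h \<in> borel_measurable (N \<Otimes>\<^sub>M M)"
  shows "(\<lambda>t. esssup M (h t)) \<in> borel_measurable N"
proof (rule borel_measurableI_le)
  fix z
  have eq: "esssup M (h t) \<le> z \<longleftrightarrow> emeasure M {y \<in> space M. z < h t y} = 0"
    if [measurable]: "t \<in> space N" for t
  proof -
    have "esssup M (h t) \<le> z \<longleftrightarrow> (AE y in M. h t y \<le> z)"
      using esssup_AE[of "h t" M] by (auto intro: esssup_I elim: eventually_mono order_trans)
    also have "\<dots> \<longleftrightarrow> emeasure M {y \<in> space M. \<not> h t y \<le> z} = 0"
      by (subst AE_iff_measurable[OF _ refl]) auto
    finally show ?thesis by (simp add: not_le)
  qed
  have "{t \<in> space N. esssup M (h t) \<le> z} = {t \<in> space N. emeasure M {y \<in> space M. z < h t y} = 0}"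
    using eq by auto
  also have "\<dots> \<in> sets N" by measurable
  finally show "{t \<in> space N. esssup M (h t) \<le> z} \<in> sets N" .
qed

text \<open>This is what allows division by the norm bound of a dilation.\<close>

lemma esssup_dilation_pos:
  fixes v w :: "real \<Rightarrow> ennreal"
  assumes v: "AE x in lborel. 0 < v x" and w: "AE y in lborel. w y < \<infinity>" and t: "t \<noteq> 0"
  shows "0 < esssup lborel (\<lambda>y. v (t * y) / w y)"
proof (rule ccontr)
  assume "\<not> ?thesis"
  then have 0: "esssup lborel (\<lambda>y. v (t * y) / w y) = 0" by simp
  have "AE y in lborel. v (t * y) / w y \<le> 0"
    using esssup_AE[of "\<lambda>y. v (t * y) / w y" lborel] unfolding 0 .
  with AE_lborel_dilation[OF v t] w have "AE y in (lborel :: real measure). False"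
    by eventually_elim auto
  then show False by (simp add: AE_iff_measurable[OF _ refl])
qed

text \<open>
  With \<open>F = \<bar>f\<bar>\<^sup>p\<close> this bounds the norm of a single dilation: substitute \<open>x = t y\<close> and use
  \<open>v (t y) \<le> S t w y\<close>.
\<close>

lemma nn_integral_dilation_weight_le:
  fixes F v w :: "real \<Rightarrow> ennreal"
  assumes [measurable]: "F \<in> borel_measurable borel" "v \<in> borel_measurable borel" "w \<in> borel_measurable borel"
    and w: "AE y in lborel. 0 < w y \<and> w y < \<infinity>" and t: "t \<noteq> 0"
  shows "(\<integral>\<^sup>+x. F (x / t) * v x \<partial>lborel)
    \<le> ennreal \<bar>t\<bar> * esssup lborel (\<lambda>y. v (t * y) / w y) * (\<integral>\<^sup>+y. F y * w y \<partial>lborel)"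
proof -
  let ?S = "esssup lborel (\<lambda>y. v (t * y) / w y)"
  have "(\<integral>\<^sup>+x. F (x / t) * v x \<partial>lborel) = ennreal \<bar>t\<bar> * (\<integral>\<^sup>+y. F y * v (t * y) \<partial>lborel)"
    using t by (subst nn_integral_real_affine[of _ t 0]) auto
  also have "(\<integral>\<^sup>+y. F y * v (t * y) \<partial>lborel) \<le> (\<integral>\<^sup>+y. ?S * (F y * w y) \<partial>lborel)"
  proof (rule nn_integral_mono_AE)
    from w esssup_AE[of "\<lambda>y. v (t * y) / w y" lborel]
    show "AE y in lborel. F y * v (t * y) \<le> ?S * (F y * w y)"
    proof eventually_elim
      case (elim y)
      then have "w y / w y = 1" by (intro ennreal_divide_self) auto
      then have "v (t * y) = v (t * y) / w y * w y"
        by (simp add: ennreal_divide_times)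
      also have "\<dots> \<le> ?S * w y"
        using elim by (intro mult_right_mono) auto
      finally have "F y * v (t * y) \<le> F y * (?S * w y)" by (rule mult_left_mono) simp
      then show ?case by (simp only: mult_ac)
    qed
  qed
  finally show ?thesis
    by (simp add: nn_integral_cmult mult_left_mono mult.assoc)
qed

section \<open>The estimate for Borel functions\<close>

text \<open>
  This is the boundedness of general Hausdorff operators. The integrand is written as the weight
  \<open>k u\<close>, with integral \<open>B\<close>, times the normalised dilation \<open>F (x / t) / u t\<close>, to which
  \<open>nn_integral_average_power_le\<close> applies.
\<close>

lemma hausdorff_average_estimate:
  fixes k F v w :: "real \<Rightarrow> ennreal" and p :: real
  assumes p: "1 < p"
    and [measurable]: "k \<in> borel_measurable borel" "F \<in> borel_measurable borel"
      "v \<in> borel_measurable borel" "w \<in> borel_measurable borel"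
    and v: "AE x in lborel. 0 < v x" and w: "AE y in lborel. 0 < w y \<and> w y < \<infinity>"
    and B: "B = (\<integral>\<^sup>+t. k t * ennpowr (ennreal \<bar>t\<bar> * esssup lborel (\<lambda>y. v (t * y) / w y)) (1 / p) \<partial>lborel)"
    and fin: "B < \<infinity>"
  shows "(\<integral>\<^sup>+x. ennpowr (\<integral>\<^sup>+t. k t * F (x / t) \<partial>lborel) p * v x \<partial>lborel)
    \<le> ennpowr B p * (\<integral>\<^sup>+y. ennpowr (F y) p * w y \<partial>lborel)"
proof -
  define S where "S t = esssup lborel (\<lambda>y. v (t * y) / w y)" for t
  define u where "u t = ennpowr (ennreal \<bar>t\<bar> * S t) (1 / p)" for t
  have [measurable]: "S \<in> borel_measurable borel"
    unfolding S_def[abs_def] by (rule lborel.borel_measurable_esssup_section) measurable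
  then have [measurable]: "u \<in> borel_measurable borel"
    unfolding u_def[abs_def] by measurable
  have t0: "AE t in lborel. t \<noteq> (0::real)" by (rule AE_lborel_singleton)
  have B_eq: "B = (\<integral>\<^sup>+t. k t * u t \<partial>lborel)" by (simp add: B u_def S_def)
  have "AE t in lborel. k t * u t \<noteq> \<infinity>"
    using fin B_eq by (intro nn_integral_noteq_infinite) auto
  then have normalise: "AE t in lborel. k t * z t = k t * u t * (z t * inverse (u t))"
    for z :: "real \<Rightarrow> ennreal"
    using t0
  proof eventually_elim
    case (elim t)
    have "S t \<noteq> 0"
      using esssup_dilation_pos[OF v _ elim(2), of w] w unfolding S_def
      by (metis (mono_tags, lifting) eventually_mono less_irrefl)
    then have "u t \<noteq> 0" using elim by (simp add: u_def)
    show ?case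
    proof (cases "u t = top")
      \<comment> \<open>here \<open>k t * u t < \<infinity>\<close> is what forces the kernel to vanish\<close>
      case True
      with elim have "k t = 0" by (auto simp: ennreal_mult_top split: if_splits)
      then show ?thesis by simp
    next
      case False
      then have "u t * inverse (u t) = 1"
        using \<open>u t \<noteq> 0\<close> ennreal_divide_self[of "u t"] by (simp add: divide_ennreal_def less_top)
      then show ?thesis by (metis mult.assoc mult.commute mult.right_neutral)
    qed
  qed
  have "(\<integral>\<^sup>+x. ennpowr (\<integral>\<^sup>+t. k t * F (x / t) \<partial>lborel) p * v x \<partial>lborel)
    = (\<integral>\<^sup>+x. ennpowr (\<integral>\<^sup>+t. k t * u t * (F (x / t) * inverse (u t)) \<partial>lborel) p * v x \<partial>lborel)"
    by (intro nn_integral_cong arg_cong2[where f = "(*)"] arg_cong2[where f = ennpowr] refl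
        nn_integral_cong_AE normalise)
  also have "\<dots> \<le> ennpowr (\<integral>\<^sup>+t. k t * u t \<partial>lborel) p * (\<integral>\<^sup>+y. ennpowr (F y) p * w y \<partial>lborel)"
  proof (rule lborel_pair.nn_integral_average_power_le[OF p])
    show "AE t in lborel. (\<integral>\<^sup>+x. ennpowr (F (x / t) * inverse (u t)) p * v x \<partial>lborel)
        \<le> (\<integral>\<^sup>+y. ennpowr (F y) p * w y \<partial>lborel)"
      using t0
    proof eventually_elim
      case (elim t)
      let ?I = "\<integral>\<^sup>+y. ennpowr (F y) p * w y \<partial>lborel"
      let ?z = "ennreal \<bar>t\<bar> * S t"
      have "ennpowr (inverse (u t)) p = inverse ?z"
        using p by (simp add: u_def ennpowr_inverse ennpowr_ennpowr)
      then have "(\<integral>\<^sup>+x. ennpowr (F (x / t) * inverse (u t)) p * v x \<partial>lborel)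
          = inverse ?z * (\<integral>\<^sup>+x. ennpowr (F (x / t)) p * v x \<partial>lborel)"
        by (subst nn_integral_cmult[symmetric]) (auto simp: ennpowr_mult mult_ac)
      also have "\<dots> \<le> inverse ?z * (?z * ?I)"
        using nn_integral_dilation_weight_le[OF _ _ _ w elim, of "\<lambda>y. ennpowr (F y) p" v]
        by (intro mult_left_mono) (auto simp: S_def)
      also have "\<dots> \<le> 1 * ?I"
      proof -
        have "inverse ?z * ?z \<le> 1"
          by (cases "?z = 0 \<or> ?z = top")
            (auto simp: ennreal_divide_self mult.commute[of "inverse _"] less_top simp flip: divide_ennreal_def)
        then show ?thesis unfolding mult.assoc[symmetric] by (rule mult_right_mono) simp
      qed
      finally show ?case by simp
    qed
  qed measurable
  finally show ?thesis by (simp add: B_eq)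
qed

section \<open>Borel representatives of Lebesgue measurable functions\<close>

text \<open>
  The preimages of the members of a countable basis are Borel up to null sets. Off the union of
  these countably many null sets \<open>f\<close> itself is Borel, so it suffices to make it constant there.
\<close>

lemma completion_ex_borel_measurable_second_countable:
  fixes f :: "'a \<Rightarrow> 'b::second_countable_topology"
  assumes f: "f \<in> borel_measurable (completion M)"
  shows "\<exists>g\<in>borel_measurable M. AE x in M. f x = g x"
proof -
  obtain B :: "'b set set" where B: "countable B" "topological_basis B"
    using ex_countable_basis by blast
  define S where "S U = f -` U \<inter> space M" for U
  have S: "S U \<in> sets (completion M)" if "U \<in> B" for U
    using measurable_sets[OF f, of U] topological_basis_open[OF B(2) that] by (simp add: S_def)
  have "AE x in M. \<forall>U\<in>B. x \<notin> null_part M (S U)"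
    using B(1) S by (subst AE_ball_countable) (auto intro: AE_notin_null_part)
  then obtain N where N: "N \<in> null_sets M" "{x \<in> space M. \<not> (\<forall>U\<in>B. x \<notin> null_part M (S U))} \<subseteq> N"
    unfolding eventually_ae_filter by auto
  define g where "g x = (if x \<in> N then undefined else f x)" for x
  have "g \<in> measurable M (sigma UNIV B)"
  proof (rule measurable_measure_of)
    fix U assume U: "U \<in> B"
    have split: "main_part M (S U) \<union> null_part M (S U) = S U"
      using S[OF U] by (rule main_part_null_part_Un)
    have "S U \<subseteq> space M" by (simp add: S_def)
    then have "null_part M (S U) \<subseteq> N" using N(2) U split by blast
    then have "main_part M (S U) - N = S U - N" using split by blast
    moreover have "g -` U \<inter> space M = (S U - N) \<union> (if undefined \<in> U then N else {})"
      using sets.sets_into_space[of N M] N(1) by (auto simp: g_def S_def split: if_splits)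
    ultimately have "g -` U \<inter> space M
        = (main_part M (S U) - N) \<union> (if undefined \<in> U then N else {})" by simp
    then show "g -` U \<inter> space M \<in> sets M"
      using N(1) main_part_sets[OF S[OF U]] by auto
  qed auto
  then have "g \<in> borel_measurable M"
    by (simp add: borel_eq_countable_basis[OF B])
  moreover have "AE x in M. f x = g x"
    using AE_not_in[OF N(1)] by eventually_elim (simp add: g_def)
  ultimately show ?thesis by blast
qed

lemma borel_measurable_completion_AE:
  assumes g: "g \<in> borel_measurable M" and eq: "AE x in M. f x = g x"
  shows "f \<in> borel_measurable (completion M)"
proof (rule measurableI)
  fix A :: "'b set" assume "A \<in> sets borel"
  then have A: "g -` A \<inter> space M \<in> sets M" using g by (rule measurable_sets[rotated])
  obtain N where N: "N \<in> null_sets M" "{x \<in> space M. f x \<noteq> g x} \<subseteq> N"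
    using eq unfolding eventually_ae_filter by auto
  have "f -` A \<inter> space M \<inter> N \<in> sets (completion M)"
    using N(1) by (rule null_sets_completion) auto
  moreover have "(g -` A \<inter> space M) - N \<in> sets (completion M)"
    using A N(1) by (auto intro!: sets_completionI_sets)
  moreover have "f -` A \<inter> space (completion M)
      = (f -` A \<inter> space M \<inter> N) \<union> ((g -` A \<inter> space M) - N)"
    using N(2) by auto
  ultimately show "f -` A \<inter> space (completion M) \<in> sets (completion M)" by (simp only: sets.Un)
qed simp

lemma esssup_completion:
  assumes g: "g \<in> borel_measurable M" and eq: "AE x in M. f x = g x"
  shows "esssup (completion M) f = esssup M g"
proof -
  have "esssup (completion M) f = esssup (completion M) g"
    using borel_measurable_completion_AE[OF g eq] measurable_completion[OF g] AE_completion[OF eq]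
    by (rule esssup_AE_cong)
  also have "\<dots> = esssup M g"
  proof (rule antisym)
    show "esssup (completion M) g \<le> esssup M g"
      using measurable_completion[OF g] AE_completion[OF esssup_AE] by (rule esssup_I)
    show "esssup M g \<le> esssup (completion M) g"
      using g esssup_AE[of g "completion M"] unfolding AE_completion_iff by (rule esssup_I)
  qed
  finally show ?thesis .
qed

section \<open>The Dunkl-Hausdorff operator\<close>

text \<open>
  This brings \<open>B_sup\<close> into the form \<open>\<integral> k u\<close>: the factor \<open>\<bar>t\<bar> powr (1 / p)\<close> moves from the
  kernel to the norm bound of the dilation.
\<close>

lemma B_sup_eq_lborel:
  fixes \<phi> \<phi>' :: "real \<Rightarrow> 'k::real_normed_vector"
  assumes p: "1 < p" and [measurable]: "v' \<in> borel_measurable borel" "w' \<in> borel_measurable borel"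
    and \<phi>: "AE t in lborel. \<phi> t = \<phi>' t" and v: "AE x in lborel. v x = v' x"
    and w: "AE x in lborel. w x = w' x"
  shows "B_sup p \<alpha> w v \<phi> = (\<integral>\<^sup>+t. ennreal (norm (\<phi>' t) / \<bar>t\<bar> powr (2 * \<alpha> + 2)) *
    ennpowr (ennreal \<bar>t\<bar> * esssup lborel (\<lambda>y. v' (t * y) / w' y)) (1 / p) \<partial>lborel)"
  unfolding B_sup_def nn_integral_completion
proof (rule nn_integral_cong_AE)
  from \<phi> AE_lborel_singleton[of 0]
  show "AE t in lborel. ennreal (norm (\<phi> t) / \<bar>t\<bar> powr (2 * \<alpha> + 2 - 1 / p)) *
      ennpowr (esssup lebesgue (\<lambda>y. v (t * y) / w y)) (1 / p)
    = ennreal (norm (\<phi>' t) / \<bar>t\<bar> powr (2 * \<alpha> + 2)) *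
      ennpowr (ennreal \<bar>t\<bar> * esssup lborel (\<lambda>y. v' (t * y) / w' y)) (1 / p)"
  proof eventually_elim
    case (elim t)
    have "AE y in lborel. v (t * y) / w y = v' (t * y) / w' y"
      using AE_lborel_dilation[OF v elim(2)] w by eventually_elim simp
    then have "esssup lebesgue (\<lambda>y. v (t * y) / w y) = esssup lborel (\<lambda>y. v' (t * y) / w' y)"
      by (intro esssup_completion) measurable
    moreover have "ennreal (norm (\<phi> t) / \<bar>t\<bar> powr (2 * \<alpha> + 2 - 1 / p))
        = ennreal (norm (\<phi>' t) / \<bar>t\<bar> powr (2 * \<alpha> + 2)) * ennpowr (ennreal \<bar>t\<bar>) (1 / p)"
      using elim by (simp add: powr_diff ennpowr_ennreal flip: ennreal_mult)
    ultimately show ?case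
      by (simp only: ennpowr_mult mult.assoc)
  qed
qed

text \<open>
  For \<open>x \<noteq> 0\<close> the integrands built from the given functions and from their Borel representatives
  agree for almost every \<open>t\<close>, so the operator may be computed with the latter. It is dominated by
  the integral \<open>G\<close> of the absolute values. The estimate for \<open>G\<close> gives the norm inequality, and
  together with \<open>v > 0\<close> it shows \<open>G < \<infinity>\<close> almost everywhere, that is, absolute convergence.
\<close>

lemma dunkl_hausdorff_estimate:
  fixes \<phi> f :: "real \<Rightarrow> 'k::{real_normed_field, banach, second_countable_topology}"
  assumes p: "1 < p" and v: "weight_function v" and w: "weight_function w"
    and \<phi>: "\<phi> \<in> borel_measurable lebesgue" and B: "B_sup p \<alpha> w v \<phi> < \<infinity>" and f: "f \<in> wLp p w"
  shows "AE x in lebesgue. integrable lebesgue (dunkl_hausdorff_integrand \<alpha> \<phi> f x)"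
    and "dunkl_hausdorff \<alpha> \<phi> f \<in> borel_measurable lebesgue"
    and "wLp_norm p v (dunkl_hausdorff \<alpha> \<phi> f) \<le> B_sup p \<alpha> w v \<phi> * wLp_norm p w f"
proof -
  obtain v' where [measurable]: "v' \<in> borel_measurable lborel" and v': "AE x in lborel. v x = v' x"
    using v completion_ex_borel_measurable unfolding weight_function_def by blast
  obtain w' where [measurable]: "w' \<in> borel_measurable lborel" and w': "AE x in lborel. w x = w' x"
    using w completion_ex_borel_measurable unfolding weight_function_def by blast
  obtain \<phi>' where [measurable]: "\<phi>' \<in> borel_measurable lborel" and \<phi>': "AE x in lborel. \<phi> x = \<phi>' x"
    using completion_ex_borel_measurable_second_countable[OF \<phi>] by blast
  obtain f' where [measurable]: "f' \<in> borel_measurable lborel" and f': "AE x in lborel. f x = f' x"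
    using f completion_ex_borel_measurable_second_countable unfolding wLp_def by blast
  have v'_pos: "AE x in lborel. 0 < v' x"
    using v v' unfolding weight_function_def AE_completion_iff by auto
  have w'_pos: "AE x in lborel. 0 < w' x \<and> w' x < \<infinity>"
    using w w' unfolding weight_function_def AE_completion_iff by auto

  let ?D = "dunkl_hausdorff_integrand \<alpha> \<phi> f" and ?D' = "dunkl_hausdorff_integrand \<alpha> \<phi>' f'"
  let ?B = "B_sup p \<alpha> w v \<phi>"
  define k where "k t = ennreal (norm (\<phi>' t) / \<bar>t\<bar> powr (2 * \<alpha> + 2))" for t
  define G where "G x = (\<integral>\<^sup>+t. k t * ennreal (norm (f' (x / t))) \<partial>lborel)" for x
  define I where "I = (\<integral>\<^sup>+y. ennpowr (ennreal (norm (f' y))) p * w' y \<partial>lborel)"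
  have [measurable]: "k \<in> borel_measurable borel" unfolding k_def[abs_def] by measurable
  have [measurable]: "G \<in> borel_measurable borel" unfolding G_def[abs_def] by measurable
  have D'_meas [measurable]: "case_prod ?D' \<in> borel_measurable (lborel \<Otimes>\<^sub>M lborel)"
    unfolding dunkl_hausdorff_integrand_def[abs_def] by measurable
  have D'_section [measurable]: "?D' x \<in> borel_measurable lborel" for x
    unfolding dunkl_hausdorff_integrand_def[abs_def] by measurable
  have G_eq: "G x = (\<integral>\<^sup>+t. ennreal (norm (?D' x t)) \<partial>lborel)" for x
    by (simp add: G_def k_def dunkl_hausdorff_integrand_def flip: ennreal_mult)
  have D_AE: "AE t in lborel. ?D x t = ?D' x t" if "x \<noteq> 0" for x
    using AE_lborel_reciprocal[OF f' that] \<phi>'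
    by eventually_elim (simp add: dunkl_hausdorff_integrand_def)
  then have D_meas: "?D x \<in> borel_measurable lebesgue" if "x \<noteq> 0" for x
    using that by (intro borel_measurable_completion_AE[OF D'_section]) auto
  have H_eq: "dunkl_hausdorff \<alpha> \<phi> f x = (\<integral>t. ?D' x t \<partial>lborel)" if "x \<noteq> 0" for x
  proof -
    have "dunkl_hausdorff \<alpha> \<phi> f x = (\<integral>t. ?D' x t \<partial>lebesgue)"
      unfolding dunkl_hausdorff_def using that D_AE
      by (intro integral_cong_AE D_meas AE_completion measurable_completion) auto
    then show ?thesis by (simp add: integral_completion)
  qed
  (* Where the integral does not converge the operator has the default value 0, so that the
     bound holds for every x other than 0. *)
  have H_le: "ennreal (norm (dunkl_hausdorff \<alpha> \<phi> f x)) \<le> G x" if "x \<noteq> 0" for x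
  proof (cases "integrable lborel (?D' x)")
    case True
    then show ?thesis
      unfolding H_eq[OF that] G_eq by (rule integral_norm_bound_ennreal)
  next
    case False
    then show ?thesis
      unfolding H_eq[OF that] by (simp add: not_integrable_integral_eq)
  qed

  have I_eq: "wLp_norm p w f = ennpowr I (1 / p)"
  proof -
    have "(\<integral>\<^sup>+x. ennreal (norm (f x) powr p) * w x \<partial>lborel) = I"
      unfolding I_def
    proof (rule nn_integral_cong_AE)
      from f' w'
      show "AE x in lborel. ennreal (norm (f x) powr p) * w x = ennpowr (ennreal (norm (f' x))) p * w' x"
        by eventually_elim (simp add: ennpowr_ennreal)
    qed
    then show ?thesis by (simp add: wLp_norm_def nn_integral_completion)
  qed
  then have "I < \<infinity>" using f by (simp add: wLp_def)
  have est: "(\<integral>\<^sup>+x. ennpowr (G x) p * v' x \<partial>lborel) \<le> ennpowr ?B p * I"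
    unfolding G_def I_def
    by (rule hausdorff_average_estimate[OF p _ _ _ _ v'_pos w'_pos _ B])
      (simp_all add: k_def B_sup_eq_lborel[OF p _ _ \<phi>' v' w'])

  show "dunkl_hausdorff \<alpha> \<phi> f \<in> borel_measurable lebesgue"
  proof (rule borel_measurable_completion_AE)
    show "(\<lambda>x. \<integral>t. ?D' x t \<partial>lborel) \<in> borel_measurable lborel"
      by measurable
    show "AE x in lborel. dunkl_hausdorff \<alpha> \<phi> f x = (\<integral>t. ?D' x t \<partial>lborel)"
      using AE_lborel_singleton[of 0] by eventually_elim (rule H_eq)
  qed

  have "ennpowr ?B p * I < \<infinity>"
    using B \<open>I < \<infinity>\<close> by (simp add: ennreal_mult_less_top)
  then have "AE x in lborel. ennpowr (G x) p * v' x \<noteq> \<infinity>"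
    using est by (intro nn_integral_noteq_infinite) auto
  with v'_pos have G_fin: "AE x in lborel. G x < \<infinity>"
  proof eventually_elim
    case (elim x)
    then show ?case
      by (cases "G x = top") (auto simp: ennreal_top_mult top.not_eq_extremum split: if_splits)
  qed
  show "AE x in lebesgue. integrable lebesgue (?D x)"
    unfolding AE_completion_iff
    using G_fin AE_lborel_singleton[of 0]
  proof eventually_elim
    case (elim x)
    then have "integrable lborel (?D' x)"
      by (intro integrableI_bounded) (auto simp: G_eq)
    then have "integrable lebesgue (?D' x)"
      by (simp add: integrable_completion)
    then show ?case
      using integrable_cong_AE[OF D_meas[OF elim(2)] measurable_completion[OF D'_section]
          AE_completion[OF D_AE[OF elim(2)]]] by simp
  qed

  have "(\<integral>\<^sup>+x. ennreal (norm (dunkl_hausdorff \<alpha> \<phi> f x) powr p) * v x \<partial>lborel)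
      \<le> (\<integral>\<^sup>+x. ennpowr (G x) p * v' x \<partial>lborel)"
  proof (rule nn_integral_mono_AE)
    from v' AE_lborel_singleton[of 0]
    show "AE x in lborel. ennreal (norm (dunkl_hausdorff \<alpha> \<phi> f x) powr p) * v x \<le> ennpowr (G x) p * v' x"
    proof eventually_elim
      case (elim x)
      then show ?case
        using p ennpowr_mono[OF _ H_le[OF elim(2)], of p]
        by (auto simp: ennpowr_ennreal intro!: mult_right_mono)
    qed
  qed
  also note est
  finally have "wLp_norm p v (dunkl_hausdorff \<alpha> \<phi> f) \<le> ennpowr (ennpowr ?B p * I) (1 / p)"
    unfolding wLp_norm_def nn_integral_completion using p by (intro ennpowr_mono) auto
  also have "\<dots> = ?B * wLp_norm p w f"
    using p by (simp add: I_eq ennpowr_mult ennpowr_ennpowr)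
  finally show "wLp_norm p v (dunkl_hausdorff \<alpha> \<phi> f) \<le> ?B * wLp_norm p w f" .
qed

theorem theorem4p1:
  fixes p \<alpha> :: real
    and v w :: "real \<Rightarrow> ennreal"
    and \<phi> :: "real \<Rightarrow> 'k::{real_normed_field, banach, second_countable_topology}"
  assumes "1 < p"
    and "weight_function v" and "weight_function w"
    and "integrable lebesgue \<phi>"
    and "B_sup p \<alpha> w v \<phi> < \<infinity>"
  shows "dunkl_hausdorff_bounded p \<alpha> w v \<phi> \<and>
    (\<forall>f\<in>wLp p w. wLp_norm p v (dunkl_hausdorff \<alpha> \<phi> f) \<le> B_sup p \<alpha> w v \<phi> * wLp_norm p w f)"
proof -
  let ?B = "B_sup p \<alpha> w v \<phi>"
  note est = dunkl_hausdorff_estimate[OF assms(1-3) borel_measurable_integrable[OF assms(4)] assms(5)]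
  have "dunkl_hausdorff \<alpha> \<phi> f \<in> wLp p v" if f: "f \<in> wLp p w" for f
  proof -
    have "?B * wLp_norm p w f < \<infinity>"
      using f assms(5) by (simp add: wLp_def ennreal_mult_less_top)
    with est(3)[OF f] have "wLp_norm p v (dunkl_hausdorff \<alpha> \<phi> f) < \<infinity>" by (rule le_less_trans)
    with est(2)[OF f] show ?thesis by (simp add: wLp_def)
  qed
  moreover have "\<exists>C\<ge>0. \<forall>f\<in>wLp p w. wLp_norm p v (dunkl_hausdorff \<alpha> \<phi> f) \<le> ennreal C * wLp_norm p w f"
  proof (intro exI conjI ballI)
    fix f :: "real \<Rightarrow> 'k"
    assume "f \<in> wLp p w"
    from est(3)[OF this] show "wLp_norm p v (dunkl_hausdorff \<alpha> \<phi> f) \<le> ennreal (enn2real ?B) * wLp_norm p w f"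
      using assms(5) by simp
  qed simp
  ultimately show ?thesis
    unfolding dunkl_hausdorff_bounded_def using est(1,3) by blast
qed

end
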